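(* Let $(X,d)$ be a cone metric space associated with a real Banach space $E$ and a cone $P\subseteq E$. Let $\{x_n\}$ and $\{y_n\}$ be two sequences in $X$ such that $d(x_n,y_n)\to 0$ in $E$ as $n\to\infty$. Let $r\in E$ with $0\ll r$ or $r=0$. Then $\{x_n\}$ is $r$-Cauchy if and only if $\{y_n\}$ is $r$-Cauchy.
   Context: Cone: a subset $P$ of a real Banach space $E$ is a cone if (i) $P$ is closed, nonempty and $P\neq\{0\}$; (ii) $ax+by\in P$ for all real $a,b\ge 0$ and all $x,y\in P$; (iii) $x\in P$ and $-x\in P$ imply $x=0$. Orderings: for $x,y\in E$, $x\le y$ means $y-x\in P$, and $x\ll y$ means $y-x\in \operatorname{int}P$ (the interior of $P$). Cone metric space: a nonempty set $X$ with a map $d:X\times X\to E$ such that for all $x,y,z\in X$: $0\le d(x,y)$, with $d(x,y)=0$ if and only if $x=y$; $d(x,y)=d(y,x)$; $d(x,y)\le d(x,z)+d(z,y)$. Convergence in $E$ is convergence in the norm of $E$. For $r\in E$ with $0\ll r$ or $r=0$, a sequence $\{x_n\}$ in $X$ is $r$-Cauchy if for every $\epsilon\in E$ with $0\ll\epsilon$ there is $m\in\mathbb{N}$ such that $d(x_i,x_j)\ll r+\epsilon$ for all $i,j\ge m$. *)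

theory Defs
  imports "HOL-Analysis.Analysis"
begin

(* Stronger than the library predicates cone and convex_cone: closed, pointed, nonzero. *)
definition banach_cone :: "'e::banach set \<Rightarrow> bool" where
  "banach_cone P \<longleftrightarrow>
     closed P \<and> P \<noteq> {} \<and> P \<noteq> {0} \<and>
     (\<forall>a b :: real. \<forall>x\<in>P. \<forall>y\<in>P. 0 \<le> a \<longrightarrow> 0 \<le> b \<longrightarrow> a *\<^sub>R x + b *\<^sub>R y \<in> P) \<and>
     (\<forall>x. x \<in> P \<longrightarrow> - x \<in> P \<longrightarrow> x = 0)"

definition cone_le :: "'e::banach set \<Rightarrow> 'e \<Rightarrow> 'e \<Rightarrow> bool" where
  "cone_le P x y \<longleftrightarrow> y - x \<in> P"

definition cone_ll :: "'e::banach set \<Rightarrow> 'e \<Rightarrow> 'e \<Rightarrow> bool" where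
  "cone_ll P x y \<longleftrightarrow> y - x \<in> interior P"

(* d is total in HOL; its values outside X are unconstrained. *)
definition cone_metric_space :: "'e::banach set \<Rightarrow> 'a set \<Rightarrow> ('a \<Rightarrow> 'a \<Rightarrow> 'e) \<Rightarrow> bool" where
  "cone_metric_space P X d \<longleftrightarrow>
     banach_cone P \<and> X \<noteq> {} \<and>
     (\<forall>x\<in>X. \<forall>y\<in>X. cone_le P 0 (d x y) \<and> (d x y = 0 \<longleftrightarrow> x = y)) \<and>
     (\<forall>x\<in>X. \<forall>y\<in>X. d x y = d y x) \<and>
     (\<forall>x\<in>X. \<forall>y\<in>X. \<forall>z\<in>X. cone_le P (d x y) (d x z + d z y))"

definition r_Cauchy :: "'e::banach set \<Rightarrow> ('a \<Rightarrow> 'a \<Rightarrow> 'e) \<Rightarrow> 'e \<Rightarrow> (nat \<Rightarrow> 'a) \<Rightarrow> bool" where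
  "r_Cauchy P d r x \<longleftrightarrow>
     (\<forall>\<epsilon>. cone_ll P 0 \<epsilon> \<longrightarrow> (\<exists>m. \<forall>i\<ge>m. \<forall>j\<ge>m. cone_ll P (d (x i) (x j)) (r + \<epsilon>)))"

end

theory Submission
  imports Defs
begin

text \<open>Going from \<open>y i\<close> to \<open>y j\<close> through \<open>x i\<close> and
  \<open>x j\<close> costs at most d(y_i,x_i) + d(x_i,x_j) + d(x_j,y_j). The middle term is
  controlled by the r-Cauchy property of \<open>x\<close>, and the outer two are eventually small in
  the order because they tend to 0 in norm (\<open>tendsto_zero_eventually_cone_ll\<close>). Weak
  and strict inequalities combine into a strict one since int P + P lies in int P
  (\<open>interior_banach_cone_add\<close>). The roles of \<open>x\<close> and \<open>y\<close> are
  interchangeable, so one implication, \<open>r_Cauchy_transfer\<close>, suffices.\<close>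

lemma banach_cone_add:
  assumes "banach_cone P" "x \<in> P" "y \<in> P"
  shows "x + y \<in> P"
proof -
  have "1 *\<^sub>R x + 1 *\<^sub>R y \<in> P"
    using assms unfolding banach_cone_def by (meson zero_le_one)
  then show ?thesis by simp
qed

lemma banach_cone_scaleR:
  assumes "banach_cone P" "x \<in> P" "0 \<le> (c::real)"
  shows "c *\<^sub>R x \<in> P"
proof -
  have "c *\<^sub>R x + 0 *\<^sub>R x \<in> P"
    using assms unfolding banach_cone_def by (meson order_refl)
  then show ?thesis by simp
qed

text \<open>The translate of int P by \<open>v\<close> is open and stays in P, so all its points are
  interior.\<close>

lemma interior_banach_cone_add:
  assumes "banach_cone P" "u \<in> interior P" "v \<in> P"
  shows "u + v \<in> interior P"
proof (rule interiorI)
  show "open ((+) v ` interior P)"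
    by (simp add: open_translation)
  show "u + v \<in> (+) v ` interior P"
    using assms(2) by (auto simp: add.commute)
  show "(+) v ` interior P \<subseteq> P"
    using assms interior_subset[of P] by (auto intro: banach_cone_add)
qed

lemma interior_banach_cone_scaleR:
  assumes "banach_cone P" "u \<in> interior P" "0 < (c::real)"
  shows "c *\<^sub>R u \<in> interior P"
proof (rule interiorI)
  show "open ((*\<^sub>R) c ` interior P)"
    using assms(3) by (simp add: open_scaling)
  show "c *\<^sub>R u \<in> (*\<^sub>R) c ` interior P"
    using assms(2) by (rule imageI)
  show "(*\<^sub>R) c ` interior P \<subseteq> P"
    using assms interior_subset[of P] by (auto intro!: banach_cone_scaleR)
qed

text \<open>The bridge from norm to order: \<epsilon> - f n tends to \<epsilon>, and int P is an
  open neighbourhood of \<epsilon>.\<close>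

lemma tendsto_zero_eventually_cone_ll:
  assumes "(f \<longlongrightarrow> 0) F" "cone_ll P 0 \<epsilon>"
  shows "\<forall>\<^sub>F n in F. cone_ll P (f n) \<epsilon>"
proof -
  have "((\<lambda>n. \<epsilon> - f n) \<longlongrightarrow> \<epsilon>) F"
    using tendsto_diff[OF tendsto_const assms(1)] by simp
  then show ?thesis
    using assms(2) unfolding cone_ll_def by (auto dest: topological_tendstoD)
qed

lemma r_Cauchy_transfer:
  assumes cms: "cone_metric_space P X d"
    and xX: "\<And>n. x n \<in> X" and yX: "\<And>n. y n \<in> X"
    and lim: "(\<lambda>n. d (x n) (y n)) \<longlonglongrightarrow> 0"
    and Cauchy: "r_Cauchy P d r x"
  shows "r_Cauchy P d r y"
  unfolding r_Cauchy_def
proof (intro allI impI)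
  fix \<epsilon> assume "cone_ll P 0 \<epsilon>"
  then have \<epsilon>: "\<epsilon> \<in> interior P" by (simp add: cone_ll_def)
  have P: "banach_cone P"
    and sym: "\<And>a b. a \<in> X \<Longrightarrow> b \<in> X \<Longrightarrow> d a b = d b a"
    and tri: "\<And>a b c. a \<in> X \<Longrightarrow> b \<in> X \<Longrightarrow> c \<in> X \<Longrightarrow> d a c + d c b - d a b \<in> P"
    using cms unfolding cone_metric_space_def cone_le_def by blast+
  \<comment> \<open>Half of \<epsilon> goes to the distance within \<open>x\<close>, a quarter to
    each of the two passages between \<open>x\<close> and \<open>y\<close>.\<close>
  have half: "cone_ll P 0 ((1/2) *\<^sub>R \<epsilon>)" and quarter: "cone_ll P 0 ((1/4) *\<^sub>R \<epsilon>)"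
    using interior_banach_cone_scaleR[OF P \<epsilon>] by (simp_all add: cone_ll_def)
  obtain m where m: "\<And>i j. i \<ge> m \<Longrightarrow> j \<ge> m \<Longrightarrow> cone_ll P (d (x i) (x j)) (r + (1/2) *\<^sub>R \<epsilon>)"
    using Cauchy half unfolding r_Cauchy_def by blast
  obtain k where k: "\<And>n. n \<ge> k \<Longrightarrow> cone_ll P (d (x n) (y n)) ((1/4) *\<^sub>R \<epsilon>)"
    using tendsto_zero_eventually_cone_ll[OF lim quarter] unfolding eventually_sequentially by blast
  have "cone_ll P (d (y i) (y j)) (r + \<epsilon>)" if "i \<ge> max m k" "j \<ge> max m k" for i j
  proof -
    \<comment> \<open>Slacks of the inequalities being added: \<open>u\<close> for the Cauchy bound,
      \<open>v\<close> for the closeness of the sequences, \<open>s\<close> and \<open>t\<close> for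
      the triangle inequalities through \<open>x i\<close> and \<open>x j\<close>. Only
      \<open>u\<close> has to be interior.\<close>
    define u where "u = r + (1/2) *\<^sub>R \<epsilon> - d (x i) (x j)"
    define v where "v n = (1/4) *\<^sub>R \<epsilon> - d (x n) (y n)" for n
    define s where "s = d (y i) (x i) + d (x i) (y j) - d (y i) (y j)"
    define t where "t = d (x i) (x j) + d (x j) (y j) - d (x i) (y j)"
    have u: "u \<in> interior P"
      using m[of i j] that by (simp add: u_def cone_ll_def)
    have v: "v i \<in> P" "v j \<in> P"
      using k[of i] k[of j] that interior_subset[of P] by (auto simp: v_def cone_ll_def)
    have st: "s \<in> P" "t \<in> P"
      using tri xX yX by (simp_all add: s_def t_def)
    have "\<epsilon> = (1/2) *\<^sub>R \<epsilon> + (1/4) *\<^sub>R \<epsilon> + (1/4) *\<^sub>R \<epsilon>"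
      by (simp flip: scaleR_left_distrib)
    \<comment> \<open>The intermediate distances cancel; symmetry is what matches d(y_i,x_i) in
      \<open>s\<close> with d(x_i,y_i) in \<open>v i\<close>.\<close>
    then have "r + \<epsilon> - d (y i) (y j) = u + (v i + v j + s + t)"
      using sym[OF yX xX, of i i] unfolding u_def v_def s_def t_def
      by (simp add: algebra_simps)
    also have "\<dots> \<in> interior P"
      by (intro interior_banach_cone_add[OF P u] banach_cone_add[OF P] v st)
    finally show ?thesis by (simp add: cone_ll_def)
  qed
  then show "\<exists>m. \<forall>i\<ge>m. \<forall>j\<ge>m. cone_ll P (d (y i) (y j)) (r + \<epsilon>)"
    by blast
qed

theorem theorem3p4:
  fixes P :: "'e::banach set" and X :: "'a set" and d :: "'a \<Rightarrow> 'a \<Rightarrow> 'e"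
    and x y :: "nat \<Rightarrow> 'a" and r :: 'e
  assumes "cone_metric_space P X d"
    and "\<forall>n. x n \<in> X" and "\<forall>n. y n \<in> X"
    and "(\<lambda>n. d (x n) (y n)) \<longlonglongrightarrow> 0"
    and "cone_ll P 0 r \<or> r = 0"
  shows "r_Cauchy P d r x \<longleftrightarrow> r_Cauchy P d r y"
proof -
  \<comment> \<open>Symmetry of \<open>d\<close> supplies the limit hypothesis for the converse,
    with the sequences exchanged.\<close>
  have "d (x n) (y n) = d (y n) (x n)" for n
    using assms(1-3) unfolding cone_metric_space_def by metis
  then have "(\<lambda>n. d (y n) (x n)) \<longlonglongrightarrow> 0"
    using assms(4) by simp
  then show ?thesis
    using assms(2-4) r_Cauchy_transfer[OF assms(1)] by blast
qed

end
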